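(* Let $\mathscr{A} = (a_{ijkl}) \in \mathbb{E}$. If $\mathbb{T}_{\mathscr{A}} \cap \mathbb{S} \neq \emptyset$, then $\mathscr{A}$ is M-PSD. If $\mathbb{T}_{\mathscr{A}} \cap (\mathbb{S} \setminus \partial\mathbb{S}) \neq \emptyset$, then $\mathscr{A}$ is M-PD.
   Context: $\mathbb{E}$ denotes the set of all real fourth-order three-dimensional tensors $\mathscr{A} = (a_{ijkl}) \in \mathbb{R}^{3\times 3\times 3\times 3}$ such that $a_{ijkl} = a_{jikl} = a_{ijlk}$ for all $i,j,k,l \in \{1,2,3\}$. For $\mathbf{x},\mathbf{y} \in \mathbb{R}^3$, set $\mathscr{A}\mathbf{x}^2\mathbf{y}^2 := \sum_{i,j,k,l=1}^3 a_{ijkl}x_ix_jy_ky_l$. The tensor $\mathscr{A} \in \mathbb{E}$ is M-positive definite (M-PD) if $\mathscr{A}\mathbf{x}^2\mathbf{y}^2 > 0$ for all nonzero $\mathbf{x},\mathbf{y} \in \mathbb{R}^3$, and M-positive semidefinite (M-PSD) if $\mathscr{A}\mathbf{x}^2\mathbf{y}^2 \geq 0$ for all $\mathbf{x},\mathbf{y} \in \mathbb{R}^3$. For a tensor $\mathscr{T} = (t_{ijkl}) \in \mathbb{R}^{3\times 3\times 3\times 3}$ and a matrix $\mathbf{Z} = (z_{ij}) \in \mathbb{R}^{3\times 3}$, set $\mathscr{T}\mathbf{Z}^2 := \sum_{i,j,k,l=1}^3 t_{ijkl}z_{ik}z_{jl}$; $\mathscr{T}$ is S-positive semidefinite (S-PSD)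 if $\mathscr{T}\mathbf{Z}^2 \geq 0$ for all $\mathbf{Z} \in \mathbb{R}^{3\times 3}$. Let $\mathbb{W} := \{\mathscr{T} \in \mathbb{R}^{3\times3\times3\times3} : t_{ijkl} = t_{jilk} \text{ for all } i,j,k,l\}$, a finite-dimensional real vector space. Define $\mathbb{T}_{\mathscr{A}} := \{\mathscr{T} \in \mathbb{W} : t_{ijkl} + t_{jikl} = 2a_{ijkl} \text{ for all } i,j,k,l\}$ and $\mathbb{S} := \{\mathscr{T} \in \mathbb{W} : \mathscr{T} \text{ is S-PSD}\}$. Here $\partial\mathbb{S}$ denotes the topological boundary of $\mathbb{S}$ in the space $\mathbb{W}$. *)

theory Defs
  imports "HOL-Analysis.Analysis"
begin

text \<open>The entry \<open>t\<^sub>i\<^sub>j\<^sub>k\<^sub>l\<close> of a tensor is \<open>T $ i $ j $ k $ l\<close>.\<close>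

type_synonym tensor4 = "real^3^3^3^3"

definition elasticity_tensors :: "tensor4 set" where
  "elasticity_tensors =
    {A. \<forall>i j k l. A $ i $ j $ k $ l = A $ j $ i $ k $ l \<and>
                  A $ i $ j $ k $ l = A $ i $ j $ l $ k}"

definition biquadratic_form :: "tensor4 \<Rightarrow> real^3 \<Rightarrow> real^3 \<Rightarrow> real" where
  "biquadratic_form A x y =
    (\<Sum>i\<in>UNIV. \<Sum>j\<in>UNIV. \<Sum>k\<in>UNIV. \<Sum>l\<in>UNIV.
      A $ i $ j $ k $ l * x $ i * x $ j * y $ k * y $ l)"

definition M_PD :: "tensor4 \<Rightarrow> bool" where
  "M_PD A \<longleftrightarrow> (\<forall>x y. x \<noteq> 0 \<longrightarrow> y \<noteq> 0 \<longrightarrow> biquadratic_form A x y > 0)"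

definition M_PSD :: "tensor4 \<Rightarrow> bool" where
  "M_PSD A \<longleftrightarrow> (\<forall>x y. biquadratic_form A x y \<ge> 0)"

text \<open>The matrix entries are paired as \<open>z\<^sub>i\<^sub>k z\<^sub>j\<^sub>l\<close>: the first index of each entry comes
  from the first index pair of the tensor, the second from its second pair.\<close>

definition matrix_quadratic_form :: "tensor4 \<Rightarrow> real^3^3 \<Rightarrow> real" where
  "matrix_quadratic_form T Z =
    (\<Sum>i\<in>UNIV. \<Sum>j\<in>UNIV. \<Sum>k\<in>UNIV. \<Sum>l\<in>UNIV.
      T $ i $ j $ k $ l * Z $ i $ k * Z $ j $ l)"

definition S_PSD :: "tensor4 \<Rightarrow> bool" where
  "S_PSD T \<longleftrightarrow> (\<forall>Z. matrix_quadratic_form T Z \<ge> 0)"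

definition paired_symmetric_tensors :: "tensor4 set" where
  "paired_symmetric_tensors =
    {T. \<forall>i j k l. T $ i $ j $ k $ l = T $ j $ i $ l $ k}"

definition decompositions :: "tensor4 \<Rightarrow> tensor4 set" where
  "decompositions A =
    {T \<in> paired_symmetric_tensors.
      \<forall>i j k l. T $ i $ j $ k $ l + T $ j $ i $ k $ l = 2 * A $ i $ j $ k $ l}"

definition S_PSD_tensors :: "tensor4 set" where
  "S_PSD_tensors = {T \<in> paired_symmetric_tensors. S_PSD T}"

text \<open>The boundary is relative to \<open>paired_symmetric_tensors\<close> with its Euclidean (subspace)
  topology. The \<open>frontier\<close> in the full tensor space would be wrong: a proper subspace has
  empty interior there, so it would contain every element of \<open>S_PSD_tensors\<close>.\<close>

definition S_PSD_boundary :: "tensor4 set" where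
  "S_PSD_boundary = top_of_set paired_symmetric_tensors frontier_of S_PSD_tensors"

end

theory Submission
  imports Defs
begin

text \<open>On a rank-one matrix \<open>x y\<^sup>T\<close> the quadratic form of a tensor in \<open>decompositions A\<close> is the
  biquadratic form of \<open>A\<close>, so S-positive semidefiniteness gives M-positive semidefiniteness. If such
  a tensor \<open>T\<close> is not on the boundary, then \<open>T - c I\<close> is still S-positive semidefinite for some
  \<open>c > 0\<close>, where \<open>I\<close> is the tensor of the Frobenius norm; evaluating at \<open>x y\<^sup>T\<close> gives
  \<open>c \<parallel>x\<parallel>\<^sup>2 \<parallel>y\<parallel>\<^sup>2\<close> as a lower bound for the biquadratic form of \<open>A\<close>.\<close>

lemma biquadratic_form_eq_matrix_quadratic_form:
  "biquadratic_form T x y = matrix_quadratic_form T (\<chi> i k. x $ i * y $ k)"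
  unfolding biquadratic_form_def matrix_quadratic_form_def by (simp add: mult_ac)

lemma biquadratic_form_nonneg:
  assumes "T \<in> S_PSD_tensors"
  shows "biquadratic_form T x y \<ge> 0"
  using assms
  by (simp add: biquadratic_form_eq_matrix_quadratic_form S_PSD_tensors_def S_PSD_def)

text \<open>The factor \<open>x $ i * x $ j\<close> is symmetric, so exchanging the first two
  indices of \<open>T\<close> preserves the form, while \<open>T\<close> and its exchanged copy add
  up to \<open>2 * A\<close>.\<close>

lemma biquadratic_form_decomposition:
  assumes "T \<in> decompositions A"
  shows "biquadratic_form T x y = biquadratic_form A x y"
proof -
  define swapped :: tensor4 where "swapped = (\<chi> i j. T $ j $ i)"
  have swap: "biquadratic_form swapped x y = biquadratic_form T x y"
    unfolding biquadratic_form_def swapped_def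
    by (subst sum.swap) (simp add: mult_ac)
  have "T $ i $ j $ k $ l + swapped $ i $ j $ k $ l = 2 * A $ i $ j $ k $ l" for i j k l
    using assms by (simp add: decompositions_def swapped_def)
  then have "biquadratic_form T x y + biquadratic_form swapped x y = 2 * biquadratic_form A x y"
    unfolding biquadratic_form_def sum_distrib_left
    by (simp flip: sum.distrib distrib_right mult.assoc)
  with swap show ?thesis by simp
qed

definition frobenius_tensor :: tensor4 where
  "frobenius_tensor = (\<chi> i j k l. if i = j \<and> k = l then 1 else 0)"

lemma biquadratic_form_frobenius_tensor:
  "biquadratic_form frobenius_tensor x y = (x \<bullet> x) * (y \<bullet> y)"
proof -
  \<comment> \<open>Nesting the conditions lets the sum over l collapse at k and, once moved inward,
    the sum over j at i.\<close>
  have "biquadratic_form frobenius_tensor x y =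
      (\<Sum>i\<in>UNIV. \<Sum>j\<in>UNIV. \<Sum>k\<in>UNIV. \<Sum>l\<in>UNIV. if l = k then if j = i
        then x $ i * x $ i * (y $ k * y $ k) else 0 else 0)"
    unfolding biquadratic_form_def frobenius_tensor_def
    by (intro sum.cong refl) auto
  also have "\<dots> = (\<Sum>i\<in>UNIV. \<Sum>k\<in>UNIV. x $ i * x $ i * (y $ k * y $ k))"
    by (subst (2) sum.swap) simp
  finally show ?thesis by (simp add: inner_vec_def sum_product)
qed

lemma biquadratic_form_diff_scaleR:
  "biquadratic_form (T - c *\<^sub>R U) x y = biquadratic_form T x y - c * biquadratic_form U x y"
  unfolding biquadratic_form_def sum_distrib_left
  by (simp add: algebra_simps sum_subtractf)

text \<open>The boundary is relative to this subspace, so a perturbation of \<open>T\<close> must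
  stay inside it.\<close>

lemma diff_scaleR_frobenius_tensor_mem:
  assumes "T \<in> paired_symmetric_tensors"
  shows "T - c *\<^sub>R frobenius_tensor \<in> paired_symmetric_tensors"
  using assms by (auto simp: paired_symmetric_tensors_def frobenius_tensor_def)

lemma S_PSD_tensors_minus_boundary:
  assumes "T \<in> S_PSD_tensors - S_PSD_boundary"
  obtains c where "c > 0" "T - c *\<^sub>R frobenius_tensor \<in> S_PSD_tensors"
proof -
  let ?W = "top_of_set paired_symmetric_tensors"
  have T: "T \<in> paired_symmetric_tensors"
    using assms by (simp add: S_PSD_tensors_def)
  have "S_PSD_tensors \<subseteq> topspace ?W"
    by (auto simp: S_PSD_tensors_def)
  \<comment> \<open>A set lies in its closure, and closure minus frontier is the interior.\<close>
  then have "T \<in> ?W interior_of S_PSD_tensors"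
    using assms closure_of_subset[of S_PSD_tensors ?W]
    by (auto simp: S_PSD_boundary_def frontier_of_def)
  then obtain e where e: "e > 0"
    and ball: "ball T e \<inter> paired_symmetric_tensors \<subseteq> S_PSD_tensors"
    unfolding interior_of_def openin_contains_ball by blast
  \<comment> \<open>The shift by \<open>c *\<^sub>R frobenius_tensor\<close> must be shorter than e;
    the \<open>+ 1\<close> keeps the denominator positive whatever the norm.\<close>
  define c where "c = e / (2 * (norm frobenius_tensor + 1))"
  have pos: "norm frobenius_tensor + 1 > 0"
    by (simp add: add_nonneg_pos)
  have "c > 0"
    using e pos by (simp add: c_def)
  have "c * norm frobenius_tensor < c * (2 * (norm frobenius_tensor + 1))"
    using \<open>c > 0\<close> pos by (intro mult_strict_left_mono) (simp_all add: add_pos_nonneg)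
  also have "\<dots> = e"
    using pos by (simp add: c_def)
  finally have "T - c *\<^sub>R frobenius_tensor \<in> ball T e"
    using \<open>c > 0\<close> by (simp add: dist_norm)
  then have "T - c *\<^sub>R frobenius_tensor \<in> S_PSD_tensors"
    using ball diff_scaleR_frobenius_tensor_mem[OF T] by blast
  with \<open>c > 0\<close> show thesis by (rule that)
qed

theorem theorem3p2:
  fixes A :: tensor4
  assumes "A \<in> elasticity_tensors"
  shows "(decompositions A \<inter> S_PSD_tensors \<noteq> {} \<longrightarrow> M_PSD A) \<and>
         (decompositions A \<inter> (S_PSD_tensors - S_PSD_boundary) \<noteq> {} \<longrightarrow> M_PD A)"
proof (intro conjI impI)
  assume "decompositions A \<inter> S_PSD_tensors \<noteq> {}"
  then show "M_PSD A"
    using biquadratic_form_nonneg biquadratic_form_decomposition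
    unfolding M_PSD_def by fastforce
next
  assume "decompositions A \<inter> (S_PSD_tensors - S_PSD_boundary) \<noteq> {}"
  then obtain T where T: "T \<in> decompositions A" "T \<in> S_PSD_tensors - S_PSD_boundary"
    by blast
  obtain c where c: "c > 0" "T - c *\<^sub>R frobenius_tensor \<in> S_PSD_tensors"
    using S_PSD_tensors_minus_boundary[OF T(2)] .
  show "M_PD A"
    unfolding M_PD_def
  proof (intro allI impI)
    fix x y :: "real^3"
    assume "x \<noteq> 0" "y \<noteq> 0"
    then have "0 < c * ((x \<bullet> x) * (y \<bullet> y))"
      using c(1) by simp
    also have "\<dots> \<le> biquadratic_form T x y"
      using biquadratic_form_nonneg[OF c(2), of x y]
      by (simp add: biquadratic_form_diff_scaleR biquadratic_form_frobenius_tensor)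
    also have "\<dots> = biquadratic_form A x y"
      by (rule biquadratic_form_decomposition[OF T(1)])
    finally show "biquadratic_form A x y > 0" .
  qed
qed

end
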